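(* For a model $L$ the following are equivalent: (1) $L$ is a strong model; (2) $L$ is a strong symmetric model; (3) $L$ is a symmetric model.
   Context: Fix a limit ordinal $\kappa$. A stratified complete lattice is $(L,\leq,(\sqsubseteq_\alpha)_{\alpha<\kappa})$ with $(L,\leq)$ a complete lattice and each $\sqsubseteq_\alpha$ a preorder; $x=_\alpha y$ means $x\sqsubseteq_\alpha y$ and $y\sqsubseteq_\alpha x$. Axioms: (A1) for $\alpha<\beta<\kappa$, $x\sqsubseteq_\beta y$ implies $x=_\alpha y$; (A2) if $x=_\alpha y$ for all $\alpha$ then $x=y$; (A3) for all $x,\alpha$ there is $y$ with $x=_\alpha y$ such that $x\sqsubseteq_\alpha z$ implies $y\leq z$ (unique, denoted $x|_\alpha$); (A4) for nonempty $I$ and $x_i=_\alpha y$ ($i\in I$), $\bigvee_i x_i=_\alpha y$; (A4$^*$) for any index set $I$ and $x_i=_\alpha y_i$, $\bigvee_i x_i=_\alpha\bigvee_i y_i$; (A5) $x\leq y$ implies $x|_\alpha\leq y|_\alpha$; (A6) if $x\leq y$ and $x=_\beta y$ for all $\beta<\alpha$ then $x\sqsubseteq_\alpha y$. Dual axioms: (A3d) for all $x,\alpha$ there is $y$ with $x=_\alpha y$ such that $z\sqsubseteq_\alpha x$ implies $z\leq y$ (unique, denoted $x|^\alpha$); (A4d) for nonempty $I$ and $x_i=_\alpha y$, $\bigwedge_i x_i=_\alpha y$; (A4$^*$d) for any index set $I$ and $x_i=_\alpha y_i$, $\bigwedge_i x_i=_\alpha\bigwedge_i y_i$; (A5d)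 $x\leq y$ implies $x|^\alpha\leq y|^\alpha$. A model satisfies A1–A6; a strong model satisfies A1, A2, A3, A4$^*$, A5, A6; a dual model satisfies A1, A2, A3d, A4d, A5d, A6; a strong dual model satisfies A1, A2, A3d, A4$^*$d, A5d, A6. A symmetric model is one that is both a model and a dual model; a strong symmetric model is both a strong model and a strong dual model. *)

theory Defs
  imports Main
begin

text \<open>
  A limit ordinal is rendered as a type \<open>'k\<close> of class \<open>wellorder\<close> and \<open>no_top\<close>: up to isomorphism,
  a nonempty well-order without a greatest element. The elements of \<open>'k\<close> are the ordinals below it.
  The complete lattice is the type \<open>'a\<close> with its class order; \<open>le \<alpha>\<close> is the preorder of stratum \<open>\<alpha>\<close>.
\<close>

definition strat_eq :: "('k \<Rightarrow> 'a \<Rightarrow> 'a \<Rightarrow> bool) \<Rightarrow> 'k \<Rightarrow> 'a \<Rightarrow> 'a \<Rightarrow> bool" where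
  "strat_eq le \<alpha> x y \<longleftrightarrow> le \<alpha> x y \<and> le \<alpha> y x"

definition stratified ::
  "('k::{wellorder,no_top} \<Rightarrow> 'a::complete_lattice \<Rightarrow> 'a \<Rightarrow> bool) \<Rightarrow> bool" where
  "stratified le \<longleftrightarrow> (\<forall>\<alpha>. reflp (le \<alpha>) \<and> transp (le \<alpha>))"

definition A1 :: "('k::wellorder \<Rightarrow> 'a \<Rightarrow> 'a \<Rightarrow> bool) \<Rightarrow> bool" where
  "A1 le \<longleftrightarrow> (\<forall>\<alpha> \<beta> x y. \<alpha> < \<beta> \<longrightarrow> le \<beta> x y \<longrightarrow> strat_eq le \<alpha> x y)"

definition A2 :: "('k \<Rightarrow> 'a \<Rightarrow> 'a \<Rightarrow> bool) \<Rightarrow> bool" where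
  "A2 le \<longleftrightarrow> (\<forall>x y. (\<forall>\<alpha>. strat_eq le \<alpha> x y) \<longrightarrow> x = y)"

definition is_lower_restr ::
  "('k \<Rightarrow> 'a::complete_lattice \<Rightarrow> 'a \<Rightarrow> bool) \<Rightarrow> 'k \<Rightarrow> 'a \<Rightarrow> 'a \<Rightarrow> bool" where
  "is_lower_restr le \<alpha> x y \<longleftrightarrow> strat_eq le \<alpha> x y \<and> (\<forall>z. le \<alpha> x z \<longrightarrow> y \<le> z)"

definition is_upper_restr ::
  "('k \<Rightarrow> 'a::complete_lattice \<Rightarrow> 'a \<Rightarrow> bool) \<Rightarrow> 'k \<Rightarrow> 'a \<Rightarrow> 'a \<Rightarrow> bool" where
  "is_upper_restr le \<alpha> x y \<longleftrightarrow> strat_eq le \<alpha> x y \<and> (\<forall>z. le \<alpha> z x \<longrightarrow> z \<le> y)"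

text \<open>
  The restrictions \<open>x|\<^sub>\<alpha>\<close> and \<open>x|\<^sup>\<alpha>\<close>; meaningful in the presence of \<open>A3\<close> and \<open>A3d\<close>, respectively.
\<close>

definition lower_restr :: "('k \<Rightarrow> 'a::complete_lattice \<Rightarrow> 'a \<Rightarrow> bool) \<Rightarrow> 'k \<Rightarrow> 'a \<Rightarrow> 'a" where
  "lower_restr le \<alpha> x = (THE y. is_lower_restr le \<alpha> x y)"

definition upper_restr :: "('k \<Rightarrow> 'a::complete_lattice \<Rightarrow> 'a \<Rightarrow> bool) \<Rightarrow> 'k \<Rightarrow> 'a \<Rightarrow> 'a" where
  "upper_restr le \<alpha> x = (THE y. is_upper_restr le \<alpha> x y)"

definition A3 :: "('k \<Rightarrow> 'a::complete_lattice \<Rightarrow> 'a \<Rightarrow> bool) \<Rightarrow> bool" where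
  "A3 le \<longleftrightarrow> (\<forall>x \<alpha>. \<exists>y. is_lower_restr le \<alpha> x y)"

definition A3d :: "('k \<Rightarrow> 'a::complete_lattice \<Rightarrow> 'a \<Rightarrow> bool) \<Rightarrow> bool" where
  "A3d le \<longleftrightarrow> (\<forall>x \<alpha>. \<exists>y. is_upper_restr le \<alpha> x y)"

text \<open>
  A definition cannot quantify over index types. Families in \<open>'a\<close> indexed by subsets of \<open>'a\<close>, and
  pairs of families indexed by subsets of \<open>'a \<times> 'a\<close>, already cover all index sets; the lemmas
  \<open>A4_family\<close>, \<open>A4star_family\<close> and their duals below give the axioms for arbitrary index types.
\<close>

definition A4 :: "('k \<Rightarrow> 'a::complete_lattice \<Rightarrow> 'a \<Rightarrow> bool) \<Rightarrow> bool" where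
  "A4 le \<longleftrightarrow> (\<forall>\<alpha> (I :: 'a set) x y. I \<noteq> {} \<longrightarrow> (\<forall>i\<in>I. strat_eq le \<alpha> (x i) y) \<longrightarrow>
     strat_eq le \<alpha> (SUP i\<in>I. x i) y)"

definition A4star :: "('k \<Rightarrow> 'a::complete_lattice \<Rightarrow> 'a \<Rightarrow> bool) \<Rightarrow> bool" where
  "A4star le \<longleftrightarrow> (\<forall>\<alpha> (I :: ('a \<times> 'a) set) x y. (\<forall>i\<in>I. strat_eq le \<alpha> (x i) (y i)) \<longrightarrow>
     strat_eq le \<alpha> (SUP i\<in>I. x i) (SUP i\<in>I. y i))"

definition A4d :: "('k \<Rightarrow> 'a::complete_lattice \<Rightarrow> 'a \<Rightarrow> bool) \<Rightarrow> bool" where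
  "A4d le \<longleftrightarrow> (\<forall>\<alpha> (I :: 'a set) x y. I \<noteq> {} \<longrightarrow> (\<forall>i\<in>I. strat_eq le \<alpha> (x i) y) \<longrightarrow>
     strat_eq le \<alpha> (INF i\<in>I. x i) y)"

definition A4stard :: "('k \<Rightarrow> 'a::complete_lattice \<Rightarrow> 'a \<Rightarrow> bool) \<Rightarrow> bool" where
  "A4stard le \<longleftrightarrow> (\<forall>\<alpha> (I :: ('a \<times> 'a) set) x y. (\<forall>i\<in>I. strat_eq le \<alpha> (x i) (y i)) \<longrightarrow>
     strat_eq le \<alpha> (INF i\<in>I. x i) (INF i\<in>I. y i))"

definition A5 :: "('k \<Rightarrow> 'a::complete_lattice \<Rightarrow> 'a \<Rightarrow> bool) \<Rightarrow> bool" where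
  "A5 le \<longleftrightarrow> (\<forall>x y \<alpha>. x \<le> y \<longrightarrow> lower_restr le \<alpha> x \<le> lower_restr le \<alpha> y)"

definition A5d :: "('k \<Rightarrow> 'a::complete_lattice \<Rightarrow> 'a \<Rightarrow> bool) \<Rightarrow> bool" where
  "A5d le \<longleftrightarrow> (\<forall>x y \<alpha>. x \<le> y \<longrightarrow> upper_restr le \<alpha> x \<le> upper_restr le \<alpha> y)"

definition A6 :: "('k::wellorder \<Rightarrow> 'a::complete_lattice \<Rightarrow> 'a \<Rightarrow> bool) \<Rightarrow> bool" where
  "A6 le \<longleftrightarrow> (\<forall>x y \<alpha>. x \<le> y \<longrightarrow> (\<forall>\<beta><\<alpha>. strat_eq le \<beta> x y) \<longrightarrow> le \<alpha> x y)"

definition model ::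
  "('k::{wellorder,no_top} \<Rightarrow> 'a::complete_lattice \<Rightarrow> 'a \<Rightarrow> bool) \<Rightarrow> bool" where
  "model le \<longleftrightarrow> stratified le \<and> A1 le \<and> A2 le \<and> A3 le \<and> A4 le \<and> A5 le \<and> A6 le"

definition strong_model ::
  "('k::{wellorder,no_top} \<Rightarrow> 'a::complete_lattice \<Rightarrow> 'a \<Rightarrow> bool) \<Rightarrow> bool" where
  "strong_model le \<longleftrightarrow> stratified le \<and> A1 le \<and> A2 le \<and> A3 le \<and> A4star le \<and> A5 le \<and> A6 le"

definition dual_model ::
  "('k::{wellorder,no_top} \<Rightarrow> 'a::complete_lattice \<Rightarrow> 'a \<Rightarrow> bool) \<Rightarrow> bool" where
  "dual_model le \<longleftrightarrow> stratified le \<and> A1 le \<and> A2 le \<and> A3d le \<and> A4d le \<and> A5d le \<and> A6 le"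

definition strong_dual_model ::
  "('k::{wellorder,no_top} \<Rightarrow> 'a::complete_lattice \<Rightarrow> 'a \<Rightarrow> bool) \<Rightarrow> bool" where
  "strong_dual_model le \<longleftrightarrow>
     stratified le \<and> A1 le \<and> A2 le \<and> A3d le \<and> A4stard le \<and> A5d le \<and> A6 le"

definition symmetric_model ::
  "('k::{wellorder,no_top} \<Rightarrow> 'a::complete_lattice \<Rightarrow> 'a \<Rightarrow> bool) \<Rightarrow> bool" where
  "symmetric_model le \<longleftrightarrow> model le \<and> dual_model le"

definition strong_symmetric_model ::
  "('k::{wellorder,no_top} \<Rightarrow> 'a::complete_lattice \<Rightarrow> 'a \<Rightarrow> bool) \<Rightarrow> bool" where
  "strong_symmetric_model le \<longleftrightarrow> strong_model le \<and> strong_dual_model le"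

lemma lower_restr_eqI:
  assumes "is_lower_restr le \<alpha> x y"
  shows "lower_restr le \<alpha> x = y"
  unfolding lower_restr_def
proof (rule the_equality)
  show "is_lower_restr le \<alpha> x y" by (fact assms)
  show "y' = y" if "is_lower_restr le \<alpha> x y'" for y'
    using that assms by (auto simp: is_lower_restr_def strat_eq_def intro: order.antisym)
qed

lemma upper_restr_eqI:
  assumes "is_upper_restr le \<alpha> x y"
  shows "upper_restr le \<alpha> x = y"
  unfolding upper_restr_def
proof (rule the_equality)
  show "is_upper_restr le \<alpha> x y" by (fact assms)
  show "y' = y" if "is_upper_restr le \<alpha> x y'" for y'
    using that assms by (auto simp: is_upper_restr_def strat_eq_def intro: order.antisym)
qed

lemma A4_family:
  fixes I :: "'i set"
  assumes "A4 le" "I \<noteq> {}" "\<And>i. i \<in> I \<Longrightarrow> strat_eq le \<alpha> (x i) y"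
  shows "strat_eq le \<alpha> (SUP i\<in>I. x i) y"
  using assms(1)[unfolded A4_def, rule_format, of "x ` I" \<alpha> "\<lambda>u. u" y] assms(2,3)
  by auto

lemma A4d_family:
  fixes I :: "'i set"
  assumes "A4d le" "I \<noteq> {}" "\<And>i. i \<in> I \<Longrightarrow> strat_eq le \<alpha> (x i) y"
  shows "strat_eq le \<alpha> (INF i\<in>I. x i) y"
  using assms(1)[unfolded A4d_def, rule_format, of "x ` I" \<alpha> "\<lambda>u. u" y] assms(2,3)
  by auto

lemma A4star_family:
  fixes I :: "'i set"
  assumes "A4star le" "\<And>i. i \<in> I \<Longrightarrow> strat_eq le \<alpha> (x i) (y i)"
  shows "strat_eq le \<alpha> (SUP i\<in>I. x i) (SUP i\<in>I. y i)"
  using assms(1)[unfolded A4star_def, rule_format, of "(\<lambda>i. (x i, y i)) ` I" \<alpha> fst snd] assms(2)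
  by (force simp: image_image)

lemma A4stard_family:
  fixes I :: "'i set"
  assumes "A4stard le" "\<And>i. i \<in> I \<Longrightarrow> strat_eq le \<alpha> (x i) (y i)"
  shows "strat_eq le \<alpha> (INF i\<in>I. x i) (INF i\<in>I. y i)"
  using assms(1)[unfolded A4stard_def, rule_format, of "(\<lambda>i. (x i, y i)) ` I" \<alpha> fst snd] assms(2)
  by (force simp: image_image)

end

theory Submission imports Defs begin

text \<open>
  By \<open>A5\<close> the classes of \<open>=\<^sub>\<alpha>\<close> are order-convex. In a symmetric model with \<open>x\<^sub>i =\<^sub>\<alpha> y\<^sub>i\<close>, put
  \<open>z\<^sub>i = x\<^sub>i|\<^sub>\<alpha> = y\<^sub>i|\<^sub>\<alpha>\<close>; then \<open>A5d\<close> gives \<open>\<Squnion>z\<^sub>i \<le> \<Squnion>x\<^sub>i \<le> (\<Squnion>z\<^sub>i)|\<^sup>\<alpha>\<close>, so \<open>\<Squnion>x\<^sub>i =\<^sub>\<alpha> \<Squnion>z\<^sub>i\<close> by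
  convexity, and likewise for \<open>y\<close>; meets are dual. In a strong model, \<open>x|\<^sup>\<alpha>\<close> is the join of the
  \<open>=\<^sub>\<alpha>\<close>-class of \<open>x\<close>: if \<open>z \<sqsubseteq>\<^sub>\<alpha> x\<close> then \<open>z|\<^sub>\<alpha> \<le> x|\<^sub>\<alpha>\<close>, so \<open>A4\<^sup>*\<close> puts \<open>z \<squnion> x\<close> in the class of \<open>x\<close>.
\<close>

lemma strat_eq_refl: "stratified le \<Longrightarrow> strat_eq le \<alpha> x x"
  by (simp add: stratified_def strat_eq_def reflpD)

lemma strat_eq_sym: "strat_eq le \<alpha> x y \<Longrightarrow> strat_eq le \<alpha> y x"
  by (simp add: strat_eq_def)

lemma strat_eq_trans:
  "stratified le \<Longrightarrow> strat_eq le \<alpha> x y \<Longrightarrow> strat_eq le \<alpha> y z \<Longrightarrow> strat_eq le \<alpha> x z"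
  unfolding stratified_def strat_eq_def by (blast dest: transpD)

lemma le_strat_eq_trans:
  "stratified le \<Longrightarrow> le \<alpha> x y \<Longrightarrow> strat_eq le \<alpha> y z \<Longrightarrow> le \<alpha> x z"
  unfolding stratified_def strat_eq_def by (blast dest: transpD)

lemma is_lower_restr_lower_restr: "A3 le \<Longrightarrow> is_lower_restr le \<alpha> x (lower_restr le \<alpha> x)"
  unfolding A3_def by (metis lower_restr_eqI)

lemma is_upper_restr_upper_restr: "A3d le \<Longrightarrow> is_upper_restr le \<alpha> x (upper_restr le \<alpha> x)"
  unfolding A3d_def by (metis upper_restr_eqI)

lemma strat_eq_lower_restr: "A3 le \<Longrightarrow> strat_eq le \<alpha> x (lower_restr le \<alpha> x)"
  by (drule is_lower_restr_lower_restr) (auto simp: is_lower_restr_def)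

lemma strat_eq_upper_restr: "A3d le \<Longrightarrow> strat_eq le \<alpha> x (upper_restr le \<alpha> x)"
  by (drule is_upper_restr_upper_restr) (auto simp: is_upper_restr_def)

lemma lower_restr_le: "A3 le \<Longrightarrow> le \<alpha> x z \<Longrightarrow> lower_restr le \<alpha> x \<le> z"
  by (drule is_lower_restr_lower_restr) (auto simp: is_lower_restr_def)

lemma le_upper_restr: "A3d le \<Longrightarrow> le \<alpha> z x \<Longrightarrow> z \<le> upper_restr le \<alpha> x"
  by (drule is_upper_restr_upper_restr) (auto simp: is_upper_restr_def)

lemma lower_restr_mono: "A5 le \<Longrightarrow> x \<le> y \<Longrightarrow> lower_restr le \<alpha> x \<le> lower_restr le \<alpha> y"
  by (simp add: A5_def)

lemma upper_restr_mono: "A5d le \<Longrightarrow> x \<le> y \<Longrightarrow> upper_restr le \<alpha> x \<le> upper_restr le \<alpha> y"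
  by (simp add: A5d_def)

lemma lower_restr_le_self: "stratified le \<Longrightarrow> A3 le \<Longrightarrow> lower_restr le \<alpha> x \<le> x"
  by (simp add: lower_restr_le stratified_def reflpD)

text \<open>The restriction of \<open>y\<close> is equivalent to \<open>y\<close>, so it too lies
  above \<open>x\<close> in \<open>le \<alpha>\<close>, and the restriction of \<open>x\<close> is
  the least such element.\<close>

lemma lower_restr_mono_strat:
  assumes "stratified le" "A3 le" "le \<alpha> x y"
  shows "lower_restr le \<alpha> x \<le> lower_restr le \<alpha> y"
  using le_strat_eq_trans[OF assms(1,3) strat_eq_lower_restr[OF assms(2)]]
  by (rule lower_restr_le[OF assms(2)])

lemma lower_restr_cong:
  "stratified le \<Longrightarrow> A3 le \<Longrightarrow> strat_eq le \<alpha> x y \<Longrightarrow> lower_restr le \<alpha> x = lower_restr le \<alpha> y"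
  by (simp add: lower_restr_mono_strat order.antisym strat_eq_def)

text \<open>\<open>A5\<close> squeezes the restriction of \<open>b\<close> between those of
  \<open>a\<close> and \<open>c\<close>, which coincide; elements with the same restriction are
  equivalent.\<close>

lemma strat_eq_convex:
  assumes "stratified le" "A3 le" "A5 le" "a \<le> b" "b \<le> c" "strat_eq le \<alpha> a c"
  shows "strat_eq le \<alpha> a b"
proof -
  have "lower_restr le \<alpha> a \<le> lower_restr le \<alpha> b" "lower_restr le \<alpha> b \<le> lower_restr le \<alpha> c"
    by (auto intro: lower_restr_mono assms)
  then have "lower_restr le \<alpha> a = lower_restr le \<alpha> b"
    using lower_restr_cong[OF assms(1,2,6)] by simp
  with strat_eq_lower_restr[OF assms(2)] have "strat_eq le \<alpha> a (lower_restr le \<alpha> b)"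
    by metis
  then show ?thesis
    by (rule strat_eq_trans[OF assms(1) _ strat_eq_sym[OF strat_eq_lower_restr[OF assms(2)]]])
qed

lemma A4star_imp_A4:
  assumes "A4star le"
  shows "A4 le"
  unfolding A4_def
proof (intro allI impI)
  fix \<alpha> I x y
  assume "I \<noteq> {}" "\<forall>i\<in>I. strat_eq le \<alpha> (x i) y"
  then show "strat_eq le \<alpha> (SUP i\<in>I. x i) y"
    \<comment> \<open>The join of the constant family is \<open>y\<close> because \<open>I\<close>
      is nonempty.\<close>
    using A4star_family[OF assms, of I \<alpha> x "\<lambda>_. y"] by simp
qed

lemma A4star_sup:
  assumes "A4star le" "strat_eq le \<alpha> x x'" "strat_eq le \<alpha> y y'"
  shows "strat_eq le \<alpha> (sup x y) (sup x' y')"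
  \<comment> \<open>A binary join is a join indexed by \<open>bool\<close>.\<close>
  using A4star_family[OF assms(1), of UNIV \<alpha> "\<lambda>b. if b then x else y" "\<lambda>b. if b then x' else y'"]
    assms(2,3) by (simp add: UNIV_bool sup_commute)

lemma symmetric_imp_A4star:
  assumes "symmetric_model le"
  shows "A4star le"
  unfolding A4star_def
proof (intro allI impI)
  fix \<alpha> I x y
  assume eq: "\<forall>i\<in>I. strat_eq le \<alpha> (x i) (y i)"
  have m: "stratified le" "A3 le" "A5 le" "A3d le" "A5d le"
    using assms by (auto simp: symmetric_model_def model_def dual_model_def)
  \<comment> \<open>Stated for arbitrary \<open>w\<close> so that it serves both \<open>x\<close>
    and \<open>y\<close>, whose families of lower restrictions are equal.\<close>
  have *: "strat_eq le \<alpha> (SUP i\<in>I. lower_restr le \<alpha> (w i)) (SUP i\<in>I. w i)" for w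
  proof (rule strat_eq_convex[OF m(1-3)])
    let ?s = "SUP i\<in>I. lower_restr le \<alpha> (w i)"
    show "?s \<le> (SUP i\<in>I. w i)"
      by (rule SUP_mono'[OF lower_restr_le_self[OF m(1,2)]])
    show "(SUP i\<in>I. w i) \<le> upper_restr le \<alpha> ?s"
    proof (rule SUP_least)
      fix i assume "i \<in> I"
      have "w i \<le> upper_restr le \<alpha> (lower_restr le \<alpha> (w i))"
        using strat_eq_lower_restr[OF m(2), of \<alpha> "w i"]
        by (intro le_upper_restr m) (simp add: strat_eq_def)
      also have "\<dots> \<le> upper_restr le \<alpha> ?s"
        by (intro upper_restr_mono SUP_upper m \<open>i \<in> I\<close>)
      finally show "w i \<le> upper_restr le \<alpha> ?s" .
    qed
    show "strat_eq le \<alpha> ?s (upper_restr le \<alpha> ?s)"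
      by (rule strat_eq_upper_restr[OF m(4)])
  qed
  have "(SUP i\<in>I. lower_restr le \<alpha> (x i)) = (SUP i\<in>I. lower_restr le \<alpha> (y i))"
    using eq by (intro SUP_cong refl lower_restr_cong m) simp
  then show "strat_eq le \<alpha> (SUP i\<in>I. x i) (SUP i\<in>I. y i)"
    using strat_eq_trans[OF m(1) strat_eq_sym[OF *[of x]], of "SUP i\<in>I. y i"] *[of y] by simp
qed

lemma symmetric_imp_A4stard:
  assumes "symmetric_model le"
  shows "A4stard le"
  unfolding A4stard_def
proof (intro allI impI)
  fix \<alpha> I x y
  assume eq: "\<forall>i\<in>I. strat_eq le \<alpha> (x i) (y i)"
  have m: "stratified le" "A3 le" "A5 le" "A3d le"
    using assms by (auto simp: symmetric_model_def model_def dual_model_def)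
  \<comment> \<open>The upper restrictions of \<open>x\<close> serve every family \<open>w\<close>
    equivalent to \<open>x\<close>, in particular \<open>x\<close> and \<open>y\<close> themselves.
    The meet of \<open>w\<close> is caught between \<open>lower_restr le \<alpha> ?s\<close> and
    \<open>?s\<close>.\<close>
  have *: "strat_eq le \<alpha> (INF i\<in>I. upper_restr le \<alpha> (x i)) (INF i\<in>I. w i)"
    if w: "\<And>i. i \<in> I \<Longrightarrow> strat_eq le \<alpha> (w i) (x i)" for w
  proof -
    let ?s = "INF i\<in>I. upper_restr le \<alpha> (x i)"
    have lo: "lower_restr le \<alpha> ?s \<le> (INF i\<in>I. w i)"
    proof (rule INF_greatest)
      fix i assume "i \<in> I"
      then have "lower_restr le \<alpha> ?s \<le> lower_restr le \<alpha> (upper_restr le \<alpha> (x i))"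
        by (intro lower_restr_mono INF_lower m)
      \<comment> \<open>The upper restriction of \<open>x i\<close> is equivalent to
        \<open>w i\<close>, so its lower restriction is below \<open>w i\<close>.\<close>
      also have "\<dots> \<le> w i"
        using strat_eq_trans[OF m(1) w[OF \<open>i \<in> I\<close>] strat_eq_upper_restr[OF m(4)]]
        by (intro lower_restr_le m) (simp add: strat_eq_def)
      finally show "lower_restr le \<alpha> ?s \<le> w i" .
    qed
    have hi: "(INF i\<in>I. w i) \<le> ?s"
      using w by (intro INF_superset_mono[OF order.refl] le_upper_restr m) (simp add: strat_eq_def)
    show ?thesis
      by (rule strat_eq_trans[OF m(1) strat_eq_lower_restr[OF m(2)]])
        (rule strat_eq_convex[OF m(1-3) lo hi strat_eq_sym[OF strat_eq_lower_restr[OF m(2)]]])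
  qed
  have "strat_eq le \<alpha> (INF i\<in>I. upper_restr le \<alpha> (x i)) (INF i\<in>I. x i)"
    by (intro * strat_eq_refl m)
  moreover have "strat_eq le \<alpha> (INF i\<in>I. upper_restr le \<alpha> (x i)) (INF i\<in>I. y i)"
    using eq by (intro *) (simp add: strat_eq_def)
  ultimately show "strat_eq le \<alpha> (INF i\<in>I. x i) (INF i\<in>I. y i)"
    by (rule strat_eq_trans[OF m(1) strat_eq_sym])
qed

lemma strong_model_is_upper_restr:
  assumes "strong_model le"
  shows "is_upper_restr le \<alpha> x (Sup {y. strat_eq le \<alpha> y x})"
  unfolding is_upper_restr_def
proof (intro conjI allI impI)
  have m: "stratified le" "A3 le" "A4star le"
    using assms by (auto simp: strong_model_def)
  let ?C = "{y. strat_eq le \<alpha> y x}"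
  have "?C \<noteq> {}"
    using strat_eq_refl[OF m(1)] by blast
  \<comment> \<open>By \<open>A4\<close> the nonempty class contains its own join.\<close>
  then have "strat_eq le \<alpha> (SUP y\<in>?C. y) x"
    by (rule A4_family[OF A4star_imp_A4[OF m(3)]]) simp
  then have "strat_eq le \<alpha> (Sup ?C) x"
    by simp
  then show "strat_eq le \<alpha> x (Sup ?C)"
    by (rule strat_eq_sym)
  fix z assume "le \<alpha> z x"
  then have "sup (lower_restr le \<alpha> z) (lower_restr le \<alpha> x) = lower_restr le \<alpha> x"
    by (simp add: lower_restr_mono_strat m sup_absorb2)
  moreover have "strat_eq le \<alpha> (sup z x) (sup (lower_restr le \<alpha> z) (lower_restr le \<alpha> x))"
    by (intro A4star_sup strat_eq_lower_restr m)
  ultimately have "strat_eq le \<alpha> (sup z x) (lower_restr le \<alpha> x)"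
    by simp
  then have "strat_eq le \<alpha> (sup z x) x"
    by (rule strat_eq_trans[OF m(1) _ strat_eq_sym[OF strat_eq_lower_restr[OF m(2)]]])
  then have "sup z x \<le> Sup ?C"
    by (intro Sup_upper CollectI)
  then show "z \<le> Sup ?C"
    by simp
qed

lemma strong_imp_dual_model:
  fixes le :: "'k::{wellorder,no_top} \<Rightarrow> 'a::complete_lattice \<Rightarrow> 'a \<Rightarrow> bool"
  assumes "strong_model le"
  shows "dual_model le"
proof -
  have m: "stratified le" "A3 le" "A4star le" "A5 le"
    using assms by (auto simp: strong_model_def)
  have A3d: "A3d le"
    unfolding A3d_def using strong_model_is_upper_restr[OF assms] by blast
  \<comment> \<open>For \<open>A5d\<close>, replace \<open>x\<close> by its upper restriction in
    \<open>sup x y = y\<close>: by \<open>A4star\<close> the new join stays in the class of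
    \<open>y\<close>, hence below the upper restriction of \<open>y\<close>.\<close>
  have "upper_restr le \<alpha> x \<le> upper_restr le \<alpha> y" if "x \<le> y" for \<alpha> x y
  proof -
    have "strat_eq le \<alpha> (sup x y) (sup (upper_restr le \<alpha> x) y)"
      by (intro A4star_sup strat_eq_upper_restr strat_eq_refl m A3d)
    then have "le \<alpha> (sup (upper_restr le \<alpha> x) y) y"
      using that by (simp add: sup_absorb2 strat_eq_def)
    then have "sup (upper_restr le \<alpha> x) y \<le> upper_restr le \<alpha> y"
      by (rule le_upper_restr[OF A3d])
    then show ?thesis by simp
  qed
  then have A5d: "A5d le"
    by (simp add: A5d_def)
  \<comment> \<open>For \<open>A4d\<close>, the meet lies between the lower restriction of
    \<open>y\<close> and any single \<open>x i\<close>, both in the class of \<open>y\<close>, so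
    convexity applies.\<close>
  have "strat_eq le \<alpha> (INF i\<in>I. x i) y"
    if ne: "I \<noteq> {}" and eq: "\<forall>i\<in>I. strat_eq le \<alpha> (x i) y" for \<alpha> and I :: "'a set" and x y
  proof -
    obtain i where i: "i \<in> I" using ne by blast
    have lo: "lower_restr le \<alpha> y \<le> (INF i\<in>I. x i)"
      using eq by (intro INF_greatest lower_restr_le m) (simp add: strat_eq_def)
    have "strat_eq le \<alpha> y (x i)"
      using eq i by (simp add: strat_eq_def)
    then have "strat_eq le \<alpha> (lower_restr le \<alpha> y) (x i)"
      by (rule strat_eq_trans[OF m(1) strat_eq_sym[OF strat_eq_lower_restr[OF m(2)]]])
    then have "strat_eq le \<alpha> (lower_restr le \<alpha> y) (INF i\<in>I. x i)"
      by (rule strat_eq_convex[OF m(1,2,4) lo INF_lower[OF i]])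
    then show ?thesis
      by (rule strat_eq_sym[OF strat_eq_trans[OF m(1) strat_eq_lower_restr[OF m(2)]]])
  qed
  then have "A4d le"
    by (simp add: A4d_def)
  with A3d A5d assms show ?thesis
    by (simp add: dual_model_def strong_model_def)
qed

theorem theorem5:
  fixes le :: "'k::{wellorder,no_top} \<Rightarrow> 'a::complete_lattice \<Rightarrow> 'a \<Rightarrow> bool"
  assumes "model le"
  shows "(strong_model le \<longleftrightarrow> strong_symmetric_model le) \<and>
         (strong_symmetric_model le \<longleftrightarrow> symmetric_model le)"
proof -
  \<comment> \<open>The equivalences follow from a cycle of three implications.\<close>
  have "symmetric_model le" if "strong_model le"
    using assms strong_imp_dual_model[OF that] by (simp add: symmetric_model_def)
  moreover have "strong_symmetric_model le" if "symmetric_model le"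
    using that symmetric_imp_A4star[OF that] symmetric_imp_A4stard[OF that]
    by (simp add: symmetric_model_def model_def dual_model_def strong_symmetric_model_def
        strong_model_def strong_dual_model_def)
  moreover have "strong_model le" if "strong_symmetric_model le"
    using that by (simp add: strong_symmetric_model_def)
  ultimately show ?thesis by blast
qed

end
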